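(* Assume $K(x,y)>0$, $\mu(x)>0$, $\nu(y)>0$ for all $x,y\in S$. Let $g_t$, $t\ge0$, be the solution of $$\dot g_t=-\log\frac{m_{g_t}}{\nu}+\mathbb E_\nu\!\left[\log\frac{m_{g_t}}{\nu}\right]\mathbf 1$$ with initial condition $g_0\in\mathcal H$, and set $m_t=m_{g_t}$. Then, for all $t\ge0$, $$\frac{d}{dt}\operatorname{KL}(m_t\,\|\,\nu)=-\left\langle\log\frac{m_t}{\nu},\mathsf K_{g_t}\log\frac{m_t}{\nu}\right\rangle=-\mathcal E_{g_t}\!\left(\log\frac{m_t}{\nu}\right).$$
   Context: Let $N\ge1$ be an integer and $S=\{1,\dots,N\}$. Let $Q\in\mathbb R^{N\times N}$ be the generator of a continuous-time Markov chain on $S$ (nonnegative off-diagonal entries, rows summing to zero) and $K=e^{Q}$. Let $\mu,\nu$ be probability distributions on $S$. Functions on $S$ are identified with vectors in $\mathbb R^S$; $\langle\cdot,\cdot\rangle$ is the standard Euclidean inner product on $\mathbb R^S$; $\mathbf 1$ is the constant function $1$; $\mathbb E_\nu[f]=\sum_{y\in S}\nu(y)f(y)$; $\log\frac{m}{\nu}$ is the function $y\mapsto\log(m(y)/\nu(y))$; $\operatorname{KL}(p\|q)=\sum_y p(y)\log\frac{p(y)}{q(y)}$. For $g\in\mathbb R^S$ set $Z_g(x)=\sum_{z\in S}K(x,z)e^{g(z)}$, $p_g(y|x)=\frac{K(x,y)e^{g(y)}}{Z_g(x)}$, $m_g(y)=\sum_{x\in S}\mu(x)p_g(y|x)$ (strictly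 positive). The gauge-fixed space is $\mathcal H=\{g\in\mathbb R^S:\mathbb E_\nu[g]=0\}$. For every $g_0\in\mathcal H$ the ODE $\dot g_t=-\log\frac{m_{g_t}}{\nu}+\mathbb E_\nu\!\left[\log\frac{m_{g_t}}{\nu}\right]\mathbf 1$ with initial condition $g_{t=0}=g_0$ has a unique global solution, which stays in $\mathcal H$. The operator $\mathsf K_g:\mathbb R^S\to\mathbb R^S$ is $$\mathsf K_g=Dm_g=\sum_{x\in S}\mu(x)\left[\operatorname{Diag}(p_g(\cdot|x))-p_g(\cdot|x)p_g(\cdot|x)^\top\right],$$ and $\mathcal E_g(f):=\langle f,\mathsf K_g f\rangle=\sum_{x\in S}\mu(x)\operatorname{Var}_{p_g(\cdot|x)}(f)$ for $f\in\mathbb R^S$. *)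

theory Defs
  imports "HOL-Analysis.Analysis"
begin

text \<open>
  The state space $S$ is a finite type \<open>'n\<close> (types are nonempty, so $N = $ \<open>CARD('n)\<close> $\ge 1$ is
  automatic). Functions and distributions on $S$ are vectors in \<open>real ^ 'n\<close>, matrices on $S$ are
  of type \<open>real ^ 'n ^ 'n\<close>; \<open>1 :: real ^ 'n\<close> is the constant function.
\<close>

definition markov_generator :: "real ^ 'n ^ 'n \<Rightarrow> bool" where
  "markov_generator Q \<longleftrightarrow>
     (\<forall>i j. i \<noteq> j \<longrightarrow> 0 \<le> Q $ i $ j) \<and> (\<forall>i. (\<Sum>j\<in>UNIV. Q $ i $ j) = 0)"

definition prob_vec :: "real ^ 'n \<Rightarrow> bool" where
  "prob_vec p \<longleftrightarrow> (\<forall>i. 0 \<le> p $ i) \<and> (\<Sum>i\<in>UNIV. p $ i) = 1"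

text \<open>
  The library's multiplication and power on vectors are componentwise, hence the explicit
  iteration of the matrix product \<open>**\<close> here.
\<close>

definition mat_pow :: "real ^ 'n ^ 'n \<Rightarrow> nat \<Rightarrow> real ^ 'n ^ 'n" where
  "mat_pow A k = (((**) A) ^^ k) (mat 1)"

definition mat_exp :: "real ^ 'n ^ 'n \<Rightarrow> real ^ 'n ^ 'n" where
  "mat_exp A = (\<Sum>k. (1 / fact k) *\<^sub>R mat_pow A k)"

definition expect :: "real ^ 'n \<Rightarrow> real ^ 'n \<Rightarrow> real" where
  "expect p f = (\<Sum>y\<in>UNIV. p $ y * f $ y)"

definition var :: "real ^ 'n \<Rightarrow> real ^ 'n \<Rightarrow> real" where
  "var p f = expect p (\<chi> y. (f $ y - expect p f)\<^sup>2)"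

definition KL :: "real ^ 'n \<Rightarrow> real ^ 'n \<Rightarrow> real" where
  "KL p q = (\<Sum>y\<in>UNIV. p $ y * ln (p $ y / q $ y))"

definition log_ratio :: "real ^ 'n \<Rightarrow> real ^ 'n \<Rightarrow> real ^ 'n" where
  "log_ratio p q = (\<chi> y. ln (p $ y / q $ y))"

definition partition_fn :: "real ^ 'n ^ 'n \<Rightarrow> real ^ 'n \<Rightarrow> 'n \<Rightarrow> real" where
  "partition_fn K g x = (\<Sum>z\<in>UNIV. K $ x $ z * exp (g $ z))"

text \<open>\<open>tilted K g x\<close> is the distribution $p_g(\cdot \mid x)$.\<close>

definition tilted :: "real ^ 'n ^ 'n \<Rightarrow> real ^ 'n \<Rightarrow> 'n \<Rightarrow> real ^ 'n" where
  "tilted K g x = (\<chi> y. K $ x $ y * exp (g $ y) / partition_fn K g x)"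

definition marginal :: "real ^ 'n ^ 'n \<Rightarrow> real ^ 'n \<Rightarrow> real ^ 'n \<Rightarrow> real ^ 'n" where
  "marginal K \<mu> g = (\<chi> y. \<Sum>x\<in>UNIV. \<mu> $ x * tilted K g x $ y)"

definition gauge_space :: "real ^ 'n \<Rightarrow> (real ^ 'n) set" where
  "gauge_space \<nu> = {g. expect \<nu> g = 0}"

definition flow_field :: "real ^ 'n ^ 'n \<Rightarrow> real ^ 'n \<Rightarrow> real ^ 'n \<Rightarrow> real ^ 'n \<Rightarrow> real ^ 'n" where
  "flow_field K \<mu> \<nu> g =
     - log_ratio (marginal K \<mu> g) \<nu> + expect \<nu> (log_ratio (marginal K \<mu> g) \<nu>) *\<^sub>R 1"

definition diag_mat :: "real ^ 'n \<Rightarrow> real ^ 'n ^ 'n" where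
  "diag_mat p = (\<chi> i j. if i = j then p $ i else 0)"

definition outer_prod :: "real ^ 'n \<Rightarrow> real ^ 'n \<Rightarrow> real ^ 'n ^ 'n" where
  "outer_prod u v = (\<chi> i j. u $ i * v $ j)"

text \<open>
  The operator $\mathsf K_g$ as a matrix; \<open>has_derivative_marginal\<close> below shows
  $\mathsf K_g = D m_g$.
\<close>

definition response_op :: "real ^ 'n ^ 'n \<Rightarrow> real ^ 'n \<Rightarrow> real ^ 'n \<Rightarrow> real ^ 'n ^ 'n" where
  "response_op K \<mu> g =
     (\<Sum>x\<in>UNIV. \<mu> $ x *\<^sub>R (diag_mat (tilted K g x) - outer_prod (tilted K g x) (tilted K g x)))"

definition energy :: "real ^ 'n ^ 'n \<Rightarrow> real ^ 'n \<Rightarrow> real ^ 'n \<Rightarrow> real ^ 'n \<Rightarrow> real" where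
  "energy K \<mu> g f = f \<bullet> (response_op K \<mu> g *v f)"


lemma abs_mat_pow_le:
  fixes A :: "real ^ 'n ^ 'n"
  shows "\<bar>mat_pow A k $ i $ j\<bar> \<le> (\<Sum>i\<in>UNIV. \<Sum>j\<in>UNIV. \<bar>A $ i $ j\<bar>) ^ k"
proof (induction k arbitrary: i)
  case 0
  show ?case by (simp add: mat_pow_def mat_def)
next
  case (Suc k)
  let ?C = "\<Sum>i\<in>UNIV. \<Sum>j\<in>UNIV. \<bar>A $ i $ j\<bar>"
  have C0: "0 \<le> ?C" by (intro sum_nonneg) auto
  have "\<bar>mat_pow A (Suc k) $ i $ j\<bar> = \<bar>\<Sum>l\<in>UNIV. A $ i $ l * mat_pow A k $ l $ j\<bar>"
    by (simp add: mat_pow_def matrix_matrix_mult_def)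
  also have "\<dots> \<le> (\<Sum>l\<in>UNIV. \<bar>A $ i $ l\<bar> * \<bar>mat_pow A k $ l $ j\<bar>)"
    by (rule order_trans[OF sum_abs]) (simp add: abs_mult)
  also have "\<dots> \<le> (\<Sum>l\<in>UNIV. \<bar>A $ i $ l\<bar> * ?C ^ k)"
    by (intro sum_mono mult_left_mono Suc.IH) auto
  also have "\<dots> = (\<Sum>l\<in>UNIV. \<bar>A $ i $ l\<bar>) * ?C ^ k"
    by (simp add: sum_distrib_right)
  also have "\<dots> \<le> ?C * ?C ^ k"
    by (intro mult_right_mono member_le_sum[of i UNIV "\<lambda>i. \<Sum>j\<in>UNIV. \<bar>A $ i $ j\<bar>"] zero_le_power C0)
      (auto intro: sum_nonneg)
  finally show ?case by simp
qed

lemma mat_exp_sums: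
  fixes A :: "real ^ 'n ^ 'n"
  shows "(\<lambda>k. (1 / fact k) *\<^sub>R mat_pow A k) sums mat_exp A"
proof -
  let ?C = "\<Sum>i\<in>UNIV. \<Sum>j\<in>UNIV. \<bar>A $ i $ j\<bar>"
  let ?M = "\<lambda>k. (\<Sum>i\<in>(UNIV::'n set). \<Sum>j\<in>(UNIV::'n set). (1 / fact k) * ?C ^ k)"
  have "summable (\<lambda>k. (1 / fact k) * ?C ^ k)"
    using summable_exp[of ?C] by (simp add: field_simps)
  then have s: "summable ?M" by (intro summable_sum) auto
  have "norm ((1 / fact k) *\<^sub>R mat_pow A k) \<le> ?M k" for k
  proof -
    have "norm ((1 / fact k) *\<^sub>R mat_pow A k)
        \<le> (\<Sum>i\<in>UNIV. norm (((1 / fact k) *\<^sub>R mat_pow A k) $ i))"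
      by (subst norm_vec_def) (rule L2_set_le_sum, simp)
    also have "\<dots> \<le> (\<Sum>i\<in>UNIV. \<Sum>j\<in>UNIV. \<bar>((1 / fact k) *\<^sub>R mat_pow A k) $ i $ j\<bar>)"
      by (intro sum_mono norm_le_l1_cart)
    also have "\<dots> \<le> ?M k"
      by (intro sum_mono) (simp add: abs_mult divide_right_mono abs_mat_pow_le)
    finally show ?thesis .
  qed
  then have "summable (\<lambda>k. (1 / fact k) *\<^sub>R mat_pow A k)"
    by (rule summable_comparison_test'[OF s])
  then show ?thesis unfolding mat_exp_def by (rule summable_sums)
qed

lemma partition_fn_pos:
  assumes "\<And>x y. 0 < K $ x $ y"
  shows "0 < partition_fn K g x"
  unfolding partition_fn_def using assms by (intro sum_pos) auto

lemma sum_tilted: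
  assumes "\<And>x y. 0 < K $ x $ y"
  shows "(\<Sum>y\<in>UNIV. tilted K g x $ y) = 1"
  using partition_fn_pos[OF assms, of g x]
  by (simp add: tilted_def partition_fn_def flip: sum_divide_distrib)

lemma response_op_mult:
  "(response_op K \<mu> g *v h) $ y =
     (\<Sum>x\<in>UNIV. \<mu> $ x * (tilted K g x $ y * (h $ y - expect (tilted K g x) h)))"
proof -
  have 1: "(\<Sum>j\<in>UNIV. \<mu> $ x * ((diag_mat p $ y $ j - outer_prod p p $ y $ j) * h $ j))
      = \<mu> $ x * (p $ y * (h $ y - expect p h))" for x and p :: "real ^ 'a"
    by (simp add: diag_mat_def outer_prod_def left_diff_distrib sum_subtractf if_distrib[of "\<lambda>u. u * _"]
        right_diff_distrib expect_def sum_distrib_left mult.assoc cong: if_cong)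
       (simp add: if_distrib[of "\<lambda>u. _ * u"] cong: if_cong)
  have "(response_op K \<mu> g *v h) $ y = (\<Sum>j\<in>UNIV. \<Sum>x\<in>UNIV. \<mu> $ x *
      ((diag_mat (tilted K g x) - outer_prod (tilted K g x) (tilted K g x)) $ y $ j * h $ j))"
    by (simp add: response_op_def matrix_vector_mult_def sum_distrib_right mult.assoc)
  then show ?thesis by (subst (asm) sum.swap) (simp add: 1)
qed

lemma has_derivative_marginal:
  assumes "\<And>x y. 0 < K $ x $ y"
  shows "(marginal K \<mu> has_derivative (\<lambda>h. response_op K \<mu> g *v h)) (at g)"
proof -
  have nz: "partition_fn K g x \<noteq> 0" for x
    using partition_fn_pos[OF assms, of g x] by simp
  have dexp: "((\<lambda>g. exp (g $ z)) has_derivative (\<lambda>h. exp (g $ z) * h $ z)) (at g)" for z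
  proof -
    have "((\<lambda>g :: real ^ 'a. g $ z) has_derivative (\<lambda>h. h $ z)) (at g)"
      by (intro bounded_linear.has_derivative[OF bounded_linear_vec_nth] has_derivative_ident)
    from DERIV_compose_FDERIV[OF DERIV_exp this] show ?thesis
      by (subst mult.commute) simp
  qed
  have dZ: "((\<lambda>g. partition_fn K g x) has_derivative
      (\<lambda>h. partition_fn K g x * expect (tilted K g x) h)) (at g)" for x
  proof -
    have "((\<lambda>g. partition_fn K g x) has_derivative
      (\<lambda>h. \<Sum>z\<in>UNIV. K $ x $ z * (exp (g $ z) * h $ z))) (at g)"
      unfolding partition_fn_def by (intro has_derivative_sum has_derivative_mult_right dexp)
    moreover have "(\<Sum>z\<in>UNIV. K $ x $ z * (exp (g $ z) * h $ z)) =
        partition_fn K g x * expect (tilted K g x) h" for h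
      unfolding expect_def sum_distrib_left
      by (intro sum.cong refl) (simp add: tilted_def nz)
    ultimately show ?thesis by simp
  qed
  have dt: "((\<lambda>g. tilted K g x $ y) has_derivative
      (\<lambda>h. tilted K g x $ y * (h $ y - expect (tilted K g x) h))) (at g)" for x y
  proof -
    have *: "(a * (e * u) * Z - a * e * (Z * E)) / (Z * Z) = a * e / Z * (u - E)"
      if "Z \<noteq> 0" for a e u Z E :: real
      using that by (simp add: field_simps)
    have "((\<lambda>g. K $ x $ y * exp (g $ y) / partition_fn K g x) has_derivative
        (\<lambda>h. (K $ x $ y * (exp (g $ y) * h $ y) * partition_fn K g x
            - K $ x $ y * exp (g $ y) * (partition_fn K g x * expect (tilted K g x) h))
          / (partition_fn K g x * partition_fn K g x))) (at g)"
      by (rule has_derivative_divide'[OF has_derivative_mult_right[OF dexp] dZ nz])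
    then show ?thesis unfolding *[OF nz] by (subst (1 2) tilted_def) simp
  qed
  have "((\<lambda>g. marginal K \<mu> g $ y) has_derivative (\<lambda>h. (response_op K \<mu> g *v h) $ y)) (at g)" for y
    unfolding marginal_def vec_lambda_beta response_op_mult
    by (intro has_derivative_sum has_derivative_mult_right dt)
  then show ?thesis
    by (subst has_derivative_componentwise_within)
       (auto simp: Basis_vec_def inner_axis)
qed

lemma energy_eq_sum_var:
  assumes "\<And>x y. 0 < K $ x $ y"
  shows "energy K \<mu> g f = (\<Sum>x\<in>UNIV. \<mu> $ x * var (tilted K g x) f)"
proof -
  have 1: "(\<Sum>y\<in>UNIV. f $ y * (p $ y * (f $ y - expect p f))) = var p f"
    if p: "(\<Sum>y\<in>UNIV. p $ y) = 1" for p
  proof -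
    have "var p f = (\<Sum>y\<in>UNIV. p $ y * ((f $ y)\<^sup>2 + (expect p f)\<^sup>2 - 2 * f $ y * expect p f))"
      unfolding var_def by (subst expect_def) (simp add: power2_diff)
    also have "\<dots> = (\<Sum>y\<in>UNIV. f $ y * (p $ y * (f $ y - expect p f)))
        + (expect p f)\<^sup>2 * (\<Sum>y\<in>UNIV. p $ y) - expect p f * (\<Sum>y\<in>UNIV. p $ y * f $ y)"
      by (simp add: sum_distrib_left sum_subtractf[symmetric] sum.distrib[symmetric]
          algebra_simps power2_eq_square)
    finally show ?thesis using p by (simp add: expect_def[symmetric] power2_eq_square)
  qed
  have "energy K \<mu> g f = (\<Sum>y\<in>UNIV. \<Sum>x\<in>UNIV.
      \<mu> $ x * (f $ y * (tilted K g x $ y * (f $ y - expect (tilted K g x) f))))"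
    by (simp add: energy_def inner_vec_def response_op_mult sum_distrib_left mult.left_commute)
  also have "\<dots> = (\<Sum>x\<in>UNIV. \<mu> $ x * var (tilted K g x) f)"
    by (subst sum.swap) (simp add: 1 sum_tilted[OF assms] flip: sum_distrib_left)
  finally show ?thesis .
qed

end

theory Submission
  imports Defs
begin

text \<open>
  Write $L = \log(m_t/\nu)$. Perturbing a positive vector $p$ in the direction $v$ changes
  $\operatorname{KL}(p\,\|\,\nu)$ at the rate $\langle v, \log(p/\nu) + \mathbf 1\rangle$
  (\<open>has_derivative_KL\<close>). Along the flow, $p = m_t$ moves with velocity
  $v = \mathsf K_{g_t} \dot g_t$, because $\mathsf K_g = D m_g$.

  The matrix $\mathsf K_g$ is a mixture of covariance matrices, so constants lie in both its right
  and its left kernel: a constant function has covariance zero with everything. The right kernel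
  (\<open>response_op_mult_one\<close>) removes the gauge term of
  $\dot g_t = -L + \mathbb E_\nu[L]\,\mathbf 1$, leaving $v = -\mathsf K_{g_t} L$. The left
  kernel (\<open>one_inner_response_op\<close>), which is conservation of the total mass of $m_g$, removes
  the $\mathbf 1$ in the derivative of $\operatorname{KL}$. What remains is
  $-\langle L, \mathsf K_{g_t} L\rangle$.
\<close>

lemma marginal_pos:
  assumes "\<And>x y. 0 < K $ x $ y" and "\<And>x. 0 < \<mu> $ x"
  shows "0 < marginal K \<mu> g $ y"
  unfolding marginal_def vec_lambda_beta tilted_def
  using assms partition_fn_pos[OF assms(1), of g] by (intro sum_pos) auto

lemma expect_one_tilted:
  assumes "\<And>x y. 0 < K $ x $ y"
  shows "expect (tilted K g x) 1 = 1"
  using sum_tilted[OF assms, of g x] by (simp add: expect_def)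

lemma response_op_mult_one:
  assumes "\<And>x y. 0 < K $ x $ y"
  shows "response_op K \<mu> g *v 1 = 0"
  by (simp add: vec_eq_iff response_op_mult expect_one_tilted[OF assms])

text \<open>
  Each conditional distribution contributes the total mass
  $\mathbb E_p[h - \mathbb E_p[h]] = 0$.
\<close>

lemma one_inner_response_op:
  assumes "\<And>x y. 0 < K $ x $ y"
  shows "1 \<bullet> (response_op K \<mu> g *v h) = 0"
proof -
  have "(\<Sum>y\<in>UNIV. p $ y * (h $ y - expect p h)) = 0" if "(\<Sum>y\<in>UNIV. p $ y) = 1" for p
    using that
    by (simp add: right_diff_distrib sum_subtractf expect_def flip: sum_distrib_right)
  then have "(\<Sum>x\<in>UNIV. \<mu> $ x *
      (\<Sum>y\<in>UNIV. tilted K g x $ y * (h $ y - expect (tilted K g x) h))) = 0"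
    by (simp add: sum_tilted[OF assms])
  then show ?thesis
    by (simp add: inner_vec_def response_op_mult sum_distrib_left)
       (subst sum.swap, simp)
qed

lemma has_derivative_KL:
  assumes p: "\<And>y. 0 < p $ y" and q: "\<And>y. 0 < q $ y"
  shows "((\<lambda>p. KL p q) has_derivative (\<lambda>v. v \<bullet> (log_ratio p q + 1))) (at p)"
proof -
  have "((\<lambda>p. p $ y * ln (p $ y / q $ y)) has_derivative
      (\<lambda>v. v $ y * (log_ratio p q + 1) $ y)) (at p)" for y
  proof -
    have "((\<lambda>u. u * ln (u / q $ y)) has_real_derivative ln (p $ y / q $ y) + 1) (at (p $ y))"
      using p[of y] q[of y] by (auto intro!: derivative_eq_intros simp: field_simps)
    moreover have "((\<lambda>p. p $ y) has_derivative (\<lambda>v. v $ y)) (at p)"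
      by (intro bounded_linear.has_derivative[OF bounded_linear_vec_nth] has_derivative_ident)
    ultimately show ?thesis
      using DERIV_compose_FDERIV by (fastforce simp: log_ratio_def)
  qed
  then show ?thesis
    unfolding KL_def inner_vec_def inner_real_def by (intro has_derivative_sum)
qed

lemma response_op_mult_flow_field:
  assumes "\<And>x y. 0 < K $ x $ y"
  shows "response_op K \<mu> g *v flow_field K \<mu> \<nu> g =
    - (response_op K \<mu> g *v log_ratio (marginal K \<mu> g) \<nu>)"
  by (simp add: flow_field_def matrix_vector_mult_diff_distrib matrix_vector_mult_scaleR
      response_op_mult_one[OF assms])

theorem proposition4p3:
  fixes Q K :: "real ^ 'n ^ 'n" and \<mu> \<nu> :: "real ^ 'n" and g :: "real \<Rightarrow> real ^ 'n"
  assumes "markov_generator Q" and "K = mat_exp Q"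
    and "prob_vec \<mu>" and "prob_vec \<nu>"
    and "\<forall>x y. 0 < K $ x $ y" and "\<forall>x. 0 < \<mu> $ x" and "\<forall>y. 0 < \<nu> $ y"
    and "g 0 \<in> gauge_space \<nu>"
    and "\<forall>t\<ge>0. (g has_vector_derivative flow_field K \<mu> \<nu> (g t)) (at t within {0..})"
  shows "\<forall>t\<ge>0.
      ((\<lambda>s. KL (marginal K \<mu> (g s)) \<nu>) has_real_derivative
         - (log_ratio (marginal K \<mu> (g t)) \<nu> \<bullet>
             (response_op K \<mu> (g t) *v log_ratio (marginal K \<mu> (g t)) \<nu>))) (at t within {0..})
    \<and> - (log_ratio (marginal K \<mu> (g t)) \<nu> \<bullet>
           (response_op K \<mu> (g t) *v log_ratio (marginal K \<mu> (g t)) \<nu>))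
       = - energy K \<mu> (g t) (log_ratio (marginal K \<mu> (g t)) \<nu>)"
proof (intro allI impI conjI)
  fix t :: real
  assume t: "0 \<le> t"
  have K: "\<And>x y. 0 < K $ x $ y" and \<mu>: "\<And>x. 0 < \<mu> $ x" and \<nu>: "\<And>y. 0 < \<nu> $ y"
    using assms by auto
  let ?L = "log_ratio (marginal K \<mu> (g t)) \<nu>"
  let ?R = "response_op K \<mu> (g t)"
  have dg: "(g has_derivative (\<lambda>s. s *\<^sub>R flow_field K \<mu> \<nu> (g t))) (at t within {0..})"
    using assms(9) t by (simp add: has_vector_derivative_def)
  have "((\<lambda>s. KL (marginal K \<mu> (g s)) \<nu>) has_derivative
      (\<lambda>s. (?R *v (s *\<^sub>R flow_field K \<mu> \<nu> (g t))) \<bullet> (?L + 1))) (at t within {0..})"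
    by (rule has_derivative_compose[OF has_derivative_compose[OF dg has_derivative_marginal[OF K]]
          has_derivative_KL[OF marginal_pos[OF K \<mu>] \<nu>]])
  moreover have "(?R *v (s *\<^sub>R flow_field K \<mu> \<nu> (g t))) \<bullet> (?L + 1) = - (?L \<bullet> (?R *v ?L)) * s" for s
    using one_inner_response_op[OF K, of \<mu> "g t" ?L]
    by (simp add: matrix_vector_mult_scaleR response_op_mult_flow_field[OF K] inner_add_left
        inner_commute)
  ultimately show "((\<lambda>s. KL (marginal K \<mu> (g s)) \<nu>) has_real_derivative - (?L \<bullet> (?R *v ?L)))
      (at t within {0..})"
    unfolding has_field_derivative_def by (simp only:)
next
  fix t :: real
  show "- (log_ratio (marginal K \<mu> (g t)) \<nu> \<bullet>
           (response_op K \<mu> (g t) *v log_ratio (marginal K \<mu> (g t)) \<nu>))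
       = - energy K \<mu> (g t) (log_ratio (marginal K \<mu> (g t)) \<nu>)"
    by (simp add: energy_def)
qed

end
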